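(* Let $T$ and $S$ be $2$-uniform tolerances on a poset $(P,\le)$ containing no infinite chain. Then $T$ and $S$ permute (i.e. $T\circ S=S\circ T$) if and only if $T$ and $S$ are amicable.
   Context: For a poset $(P,\le)$, $x\prec y$ means that $y$ covers $x$, i.e. $x<y$ and there is no $z$ with $x<z<y$. Suprema and infima, when they exist in $(P,\le)$, are denoted $x\vee y$ and $x\wedge y$. A tolerance on a poset $(P,\le)$ is a reflexive and symmetric binary relation $T$ on $P$ satisfying: (1) if $(x,y),(z,u)\in T$ and $x\vee z$ and $y\vee u$ exist, then $(x\vee z,y\vee u)\in T$; (2) if $(x,y),(z,u)\in T$ and $x\wedge z$ and $y\wedge u$ exist, then $(x\wedge z,y\wedge u)\in T$; (3) if $x,y,z\in P$, $(x,y),(y,z)\in T$ and $T\neq P^2$, then there exist $u,v\in P$ with $u\le x,y,z\le v$ and $(u,y),(y,v)\in T$; (4) if $(x,y)\in T$ and $T\ne P^2$, then there exists $(z,u)\in T$ with $z\le x,y\le u$ such that $(v,z),(v,u)\in T$ for all $v\in P$ with $(v,x),(v,y)\in T$. A block of $T$ is a maximal subset $B\subseteq P$ with $B^2\subseteq T$. The tolerance $T$ is $2$-uniform if every block of $T$ has exactly two elements. The relational product is $T\circ S=\{(a,b)\in P^2:\exists c\in P,\ (a,c)\in T,\ (c,b)\in S\}$. For $a,b\in P$, $a$ is a lower $T$-neighbor of $b$ and $b$ an upper $T$-neighbor of $a$ if $a\prec b$ and $(a,b)\in T$ (similarly for $S$). An element $a$ is a split $(T,S)$-bottom if there exist an upper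 $T$-neighbor $b$ of $a$ and an upper $S$-neighbor of $a$ different from $b$; an adherent $(T,S)$-bottom if some element is both an upper $T$-neighbor and an upper $S$-neighbor of $a$; a $(T,S)$-bottom if it is a split or an adherent $(T,S)$-bottom. Dually: $a$ is a split $(T,S)$-top if there exist a lower $T$-neighbor $b$ of $a$ and a lower $S$-neighbor of $a$ different from $b$; an adherent $(T,S)$-top if some element is both a lower $T$-neighbor and a lower $S$-neighbor of $a$; a $(T,S)$-top if it is either. $T$ and $S$ are amicable if for all $a,b\in P$: (5) if $a\ne b$ and some lower $T$-neighbor of $a$ is a lower $S$-neighbor of $b$, then some upper $S$-neighbor of $a$ is an upper $T$-neighbor of $b$; (6) if $a\ne b$ and some upper $T$-neighbor of $a$ is an upper $S$-neighbor of $b$, then some lower $S$-neighbor of $a$ is a lower $T$-neighbor of $b$; (7) if $a$ is a $(T,S)$-top and $b$ is an upper $T$-neighbor or an upper $S$-neighbor of $a$, then $b$ is a $(T,S)$-top; (8) if $a$ is a $(T,S)$-bottom and $b$ is a lower $T$-neighbor or a lower $S$-neighbor of $a$, then $b$ is a $(T,S)$-bottom. *)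

theory Defs
  imports "HOL-Library.Lub_Glb"
begin

text \<open>The poset is the whole type \<open>'a :: order\<close>, so that \<open>P\<^sup>2\<close> is \<^term>\<open>UNIV :: ('a \<times> 'a) set\<close>.
  Joins and meets are partial: \<open>isLub UNIV {x, y} s\<close> says that \<open>x \<or> y\<close> exists and equals \<open>s\<close>,
  and dually for \<open>isGlb\<close>.\<close>

definition covered_by :: "'a::order \<Rightarrow> 'a \<Rightarrow> bool"  (infix \<open>\<prec>\<close> 50)
  where "x \<prec> y \<longleftrightarrow> x < y \<and> \<not> (\<exists>z. x < z \<and> z < y)"

definition tolerance :: "('a::order \<times> 'a) set \<Rightarrow> bool"
  where "tolerance T \<longleftrightarrow>
    refl T \<and> sym T \<and>
    (\<forall>x y z u s t. (x, y) \<in> T \<and> (z, u) \<in> T \<and> isLub UNIV {x, z} s \<and> isLub UNIV {y, u} t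
        \<longrightarrow> (s, t) \<in> T) \<and>
    (\<forall>x y z u s t. (x, y) \<in> T \<and> (z, u) \<in> T \<and> isGlb UNIV {x, z} s \<and> isGlb UNIV {y, u} t
        \<longrightarrow> (s, t) \<in> T) \<and>
    (\<forall>x y z. (x, y) \<in> T \<and> (y, z) \<in> T \<and> T \<noteq> UNIV
        \<longrightarrow> (\<exists>u v. u \<le> x \<and> u \<le> y \<and> u \<le> z \<and> x \<le> v \<and> y \<le> v \<and> z \<le> v \<and>
                   (u, y) \<in> T \<and> (y, v) \<in> T)) \<and>
    (\<forall>x y. (x, y) \<in> T \<and> T \<noteq> UNIV
        \<longrightarrow> (\<exists>z u. (z, u) \<in> T \<and> z \<le> x \<and> z \<le> y \<and> x \<le> u \<and> y \<le> u \<and>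
                   (\<forall>v. (v, x) \<in> T \<and> (v, y) \<in> T \<longrightarrow> (v, z) \<in> T \<and> (v, u) \<in> T)))"

definition block :: "('a \<times> 'a) set \<Rightarrow> 'a set \<Rightarrow> bool"
  where "block T B \<longleftrightarrow> B \<times> B \<subseteq> T \<and> (\<forall>C. B \<subseteq> C \<and> C \<times> C \<subseteq> T \<longrightarrow> C = B)"

definition two_uniform :: "('a \<times> 'a) set \<Rightarrow> bool"
  where "two_uniform T \<longleftrightarrow> (\<forall>B. block T B \<longrightarrow> card B = 2)"

definition lower_nb :: "('a::order \<times> 'a) set \<Rightarrow> 'a \<Rightarrow> 'a \<Rightarrow> bool"
  where "lower_nb T a b \<longleftrightarrow> a \<prec> b \<and> (a, b) \<in> T"

definition upper_nb :: "('a::order \<times> 'a) set \<Rightarrow> 'a \<Rightarrow> 'a \<Rightarrow> bool"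
  where "upper_nb T b a \<longleftrightarrow> a \<prec> b \<and> (a, b) \<in> T"

definition split_bottom :: "('a::order \<times> 'a) set \<Rightarrow> ('a \<times> 'a) set \<Rightarrow> 'a \<Rightarrow> bool"
  where "split_bottom T S a \<longleftrightarrow> (\<exists>b c. upper_nb T b a \<and> upper_nb S c a \<and> c \<noteq> b)"

definition adherent_bottom :: "('a::order \<times> 'a) set \<Rightarrow> ('a \<times> 'a) set \<Rightarrow> 'a \<Rightarrow> bool"
  where "adherent_bottom T S a \<longleftrightarrow> (\<exists>b. upper_nb T b a \<and> upper_nb S b a)"

definition is_bottom :: "('a::order \<times> 'a) set \<Rightarrow> ('a \<times> 'a) set \<Rightarrow> 'a \<Rightarrow> bool"
  where "is_bottom T S a \<longleftrightarrow> split_bottom T S a \<or> adherent_bottom T S a"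

definition split_top :: "('a::order \<times> 'a) set \<Rightarrow> ('a \<times> 'a) set \<Rightarrow> 'a \<Rightarrow> bool"
  where "split_top T S a \<longleftrightarrow> (\<exists>b c. lower_nb T b a \<and> lower_nb S c a \<and> c \<noteq> b)"

definition adherent_top :: "('a::order \<times> 'a) set \<Rightarrow> ('a \<times> 'a) set \<Rightarrow> 'a \<Rightarrow> bool"
  where "adherent_top T S a \<longleftrightarrow> (\<exists>b. lower_nb T b a \<and> lower_nb S b a)"

definition is_top :: "('a::order \<times> 'a) set \<Rightarrow> ('a \<times> 'a) set \<Rightarrow> 'a \<Rightarrow> bool"
  where "is_top T S a \<longleftrightarrow> split_top T S a \<or> adherent_top T S a"

definition amicable :: "('a::order \<times> 'a) set \<Rightarrow> ('a \<times> 'a) set \<Rightarrow> bool"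
  where "amicable T S \<longleftrightarrow> (\<forall>a b.
    (a \<noteq> b \<and> (\<exists>c. lower_nb T c a \<and> lower_nb S c b)
        \<longrightarrow> (\<exists>d. upper_nb S d a \<and> upper_nb T d b)) \<and>
    (a \<noteq> b \<and> (\<exists>c. upper_nb T c a \<and> upper_nb S c b)
        \<longrightarrow> (\<exists>d. lower_nb S d a \<and> lower_nb T d b)) \<and>
    (is_top T S a \<and> (upper_nb T b a \<or> upper_nb S b a) \<longrightarrow> is_top T S b) \<and>
    (is_bottom T S a \<and> (lower_nb T b a \<or> lower_nb S b a) \<longrightarrow> is_bottom T S b))"

end

theory Submission
  imports Defs
begin

text \<open>For a 2-uniform tolerance \<open>T \<noteq> P\<^sup>2\<close>, conditions (3) and (4) force distinct \<open>T\<close>-related elements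
  to form a covering pair, and every element to have at most one upper, at most one lower, and at
  least one \<open>T\<close>-neighbor. Thus the graph of \<open>T\<close> is a disjoint union of paths.

  If \<open>T\<close> and \<open>S\<close> permute, then a pair \<open>a T c S b\<close> is completed by some \<open>a S d T b\<close>, and all
  positions of \<open>d\<close> but the one required by amicability contradict the covering property or,
  for a four-element crown, compatibility of \<open>T\<close> with joins or meets.

  Conversely, the only pairs \<open>a T c S b\<close> not settled by (5) and (6) are those with
  \<open>a \<prec> c \<prec> b\<close> or \<open>b \<prec> c \<prec> a\<close>. If no completion \<open>d\<close> exists, then \<open>a\<close>, \<open>c\<close> are neither tops nor
  bottoms, and (6) and (8) propagate this upwards along a chain of neighbors that are
  alternately \<open>T\<close>- and \<open>S\<close>-related; this chain never ends.\<close>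

section \<open>Tops, bottoms and amicability in terms of lower neighbors\<close>

lemma upper_nb_iff_lower_nb: "upper_nb T b a \<longleftrightarrow> lower_nb T a b"
  by (simp add: upper_nb_def lower_nb_def)

text \<open>The split and adherent cases differ only in whether the two lower neighbors
  coincide.\<close>

lemma is_top_iff: "is_top T S a \<longleftrightarrow> (\<exists>b. lower_nb T b a) \<and> (\<exists>b. lower_nb S b a)"
  unfolding is_top_def split_top_def adherent_top_def by metis

lemma is_bottom_iff: "is_bottom T S a \<longleftrightarrow> (\<exists>b. lower_nb T a b) \<and> (\<exists>b. lower_nb S a b)"
  unfolding is_bottom_def split_bottom_def adherent_bottom_def upper_nb_iff_lower_nb by metis

lemma amicable_iff:
  "amicable T S \<longleftrightarrow> (\<forall>a b.
    (a \<noteq> b \<and> (\<exists>c. lower_nb T c a \<and> lower_nb S c b)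
        \<longrightarrow> (\<exists>d. lower_nb S a d \<and> lower_nb T b d)) \<and>
    (a \<noteq> b \<and> (\<exists>c. lower_nb T a c \<and> lower_nb S b c)
        \<longrightarrow> (\<exists>d. lower_nb S d a \<and> lower_nb T d b)) \<and>
    (is_top T S a \<and> (lower_nb T a b \<or> lower_nb S a b) \<longrightarrow> is_top T S b) \<and>
    (is_bottom T S a \<and> (lower_nb T b a \<or> lower_nb S b a) \<longrightarrow> is_bottom T S b))"
  unfolding amicable_def upper_nb_iff_lower_nb by (rule refl)

text \<open>Exchanging \<open>T\<close> with \<open>S\<close> and also \<open>a\<close> with
  \<open>b\<close> maps each completion condition to itself; tops and bottoms are symmetric in
  \<open>T\<close> and \<open>S\<close>.\<close>

lemma amicable_sym: "amicable T S \<Longrightarrow> amicable S T"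
  unfolding amicable_iff is_top_iff is_bottom_iff by metis

lemma lower_nb_less: "lower_nb T x y \<Longrightarrow> x < y"
  by (simp add: lower_nb_def covered_by_def)

lemma lower_nb_between: "lower_nb T x y \<Longrightarrow> x < z \<Longrightarrow> z < y \<Longrightarrow> False"
  by (auto simp: lower_nb_def covered_by_def)

lemma lower_nb_rel: "lower_nb T x y \<Longrightarrow> (x, y) \<in> T"
  by (simp add: lower_nb_def)

section \<open>Tolerances and their blocks\<close>

lemma isLub_pair_le: "x \<le> y \<Longrightarrow> isLub UNIV {x, y} (y::'a::order)"
  by (auto simp: isLub_def leastP_def isUb_def setle_def setge_def)

lemma isGlb_pair_le: "x \<le> y \<Longrightarrow> isGlb UNIV {x, y} (x::'a::order)"
  by (auto simp: isGlb_def greatestP_def isLb_def setle_def setge_def)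

lemma tolerance_join:
  assumes "tolerance T" "(x, y) \<in> T" "(z, u) \<in> T" "isLub UNIV {x, z} s" "isLub UNIV {y, u} t"
  shows "(s, t) \<in> T"
  using assms unfolding tolerance_def by blast

lemma tolerance_meet:
  assumes "tolerance T" "(x, y) \<in> T" "(z, u) \<in> T" "isGlb UNIV {x, z} s" "isGlb UNIV {y, u} t"
  shows "(s, t) \<in> T"
  using assms unfolding tolerance_def by blast

lemma tolerance_refl: "tolerance T \<Longrightarrow> (x, x) \<in> T"
  unfolding tolerance_def by (elim conjE) (rule refl_onD[OF _ UNIV_I])

lemma tolerance_sym: "tolerance T \<Longrightarrow> (x, y) \<in> T \<Longrightarrow> (y, x) \<in> T"
  unfolding tolerance_def by (elim conjE) (rule symD)

text \<open>Zorn's lemma: any two elements of the union of a chain already lie in one member, so the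
  square of the union stays inside \<open>T\<close>.\<close>

lemma ex_block_containing:
  assumes "A \<times> A \<subseteq> T"
  obtains B where "block T B" "A \<subseteq> B"
proof -
  let ?F = "{C. A \<subseteq> C \<and> C \<times> C \<subseteq> T}"
  have "\<exists>M\<in>?F. \<forall>X\<in>?F. M \<subseteq> X \<longrightarrow> X = M"
  proof (rule subset_Zorn_nonempty)
    show "?F \<noteq> {}" using assms by blast
  next
    fix K assume "K \<noteq> {}" and ch: "subset.chain ?F K"
    then have "A \<subseteq> \<Union>K" unfolding subset_chain_def by blast
    moreover have "\<Union>K \<times> \<Union>K \<subseteq> T"
    proof clarify
      fix x y X Y assume xy: "x \<in> X" "X \<in> K" "y \<in> Y" "Y \<in> K"
      then have "X \<subseteq> Y \<or> Y \<subseteq> X" "X \<times> X \<subseteq> T" "Y \<times> Y \<subseteq> T"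
        using ch unfolding subset_chain_def by blast+
      then show "(x, y) \<in> T" using xy by blast
    qed
    ultimately show "\<Union>K \<in> ?F" by blast
  qed
  then obtain M where M: "M \<in> ?F" and max: "\<forall>X\<in>?F. M \<subseteq> X \<longrightarrow> X = M" by (elim bexE)
  have "block T M"
    unfolding block_def
  proof (intro conjI allI impI)
    show "M \<times> M \<subseteq> T" using M by simp
    fix C assume C: "M \<subseteq> C \<and> C \<times> C \<subseteq> T"
    then have "C \<in> ?F" using M by auto
    then show "C = M" using max C by simp
  qed
  moreover have "A \<subseteq> M" using M by simp
  ultimately show ?thesis by (rule that)
qed

text \<open>Three pairwise related elements would share a block, which has only two
  elements.\<close>

lemma no_triangle:
  assumes "tolerance T" "two_uniform T" "(x, y) \<in> T" "(y, z) \<in> T" "(x, z) \<in> T"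
    and "x \<noteq> y" "y \<noteq> z" "x \<noteq> z"
  shows False
proof -
  have "{x, y, z} \<times> {x, y, z} \<subseteq> T"
    using assms tolerance_refl tolerance_sym by fastforce
  then obtain B where B: "block T B" "{x, y, z} \<subseteq> B" by (rule ex_block_containing)
  then have "card B = 2" using assms(2) by (simp add: two_uniform_def)
  moreover have "card {x, y, z} = 3" using assms by simp
  \<comment> \<open>\<open>card B = 2\<close> also makes \<open>B\<close> finite, since infinite
    sets have cardinality 0.\<close>
  ultimately show False
    using card_mono[of B "{x, y, z}"] B(2) card.infinite by fastforce
qed

lemma ex_related_distinct:
  assumes "tolerance T" "two_uniform T"
  obtains y where "(x, y) \<in> T" "y \<noteq> x"
proof -
  have "{x} \<times> {x} \<subseteq> T" using assms(1) tolerance_refl by blast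
  then obtain B where B: "block T B" "{x} \<subseteq> B" by (rule ex_block_containing)
  then have "card B = 2" using assms(2) by (simp add: two_uniform_def)
  then obtain p q where "B = {p, q}" "p \<noteq> q" by (auto simp: card_2_iff)
  moreover have "B \<times> B \<subseteq> T" using B(1) by (simp add: block_def)
  ultimately have "(x, p) \<in> T \<and> p \<noteq> x \<or> (x, q) \<in> T \<and> q \<noteq> x" using B(2) by auto
  then show ?thesis using that by blast
qed

section \<open>A single 2-uniform tolerance other than the full relation\<close>

locale proper_two_uniform =
  fixes T :: "('a::order \<times> 'a) set"
  assumes tol: "tolerance T" and unif: "two_uniform T" and proper: "T \<noteq> UNIV"
begin

lemma related_cases:
  assumes "(x, y) \<in> T"
  shows "x = y \<or> lower_nb T x y \<or> lower_nb T y x"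
proof -
  have cover: "lower_nb T x y" if xy: "(x, y) \<in> T" "x < y" for x y
  proof -
    have False if w: "x < w" "w < y" for w
    proof -
      \<comment> \<open>The join of \<open>(x, y)\<close> with \<open>(w, w)\<close> gives
        \<open>(w, y)\<close>, the meet gives \<open>(x, w)\<close>: a triangle.\<close>
      have "(w, y) \<in> T"
        using tolerance_join[OF tol xy(1) tolerance_refl[OF tol, of w]] w
        by (simp add: isLub_pair_le insert_commute[of y w])
      moreover have "(x, w) \<in> T"
        using tolerance_meet[OF tol xy(1) tolerance_refl[OF tol, of w]] w
        by (simp add: isGlb_pair_le insert_commute[of y w])
      ultimately show False using no_triangle[OF tol unif, of x w y] xy w by auto
    qed
    then show ?thesis using xy by (auto simp: lower_nb_def covered_by_def)
  qed
  have "x < y \<or> y < x" if "x \<noteq> y"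
  proof -
    have "\<forall>x y. (x, y) \<in> T \<and> T \<noteq> UNIV
        \<longrightarrow> (\<exists>z u. (z, u) \<in> T \<and> z \<le> x \<and> z \<le> y \<and> x \<le> u \<and> y \<le> u \<and>
                   (\<forall>v. (v, x) \<in> T \<and> (v, y) \<in> T \<longrightarrow> (v, z) \<in> T \<and> (v, u) \<in> T))"
      using tol unfolding tolerance_def by (elim conjE)
    then obtain z u where zu: "(z, u) \<in> T" "z \<le> x" "z \<le> y" "x \<le> u" "y \<le> u"
      and ext: "\<And>v. (v, x) \<in> T \<Longrightarrow> (v, y) \<in> T \<Longrightarrow> (v, z) \<in> T \<and> (v, u) \<in> T"
      using assms proper by blast
    \<comment> \<open>\<open>ext\<close> with \<open>v\<close> taken as \<open>x\<close> and as
      \<open>y\<close>. To avoid a triangle, the lower bound \<open>z\<close> must be one of the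
      two.\<close>
    have "(x, z) \<in> T" "(y, z) \<in> T"
      using ext assms tolerance_refl[OF tol] tolerance_sym[OF tol] by blast+
    then have "z = x \<or> z = y"
      using no_triangle[OF tol unif, of x y z] assms that by blast
    then show ?thesis using zu that by auto
  qed
  then show ?thesis using cover assms tolerance_sym[OF tol assms] by blast
qed

lemma related_lower_nb:
  assumes "(x, y) \<in> T" "x < y"
  shows "lower_nb T x y"
  using related_cases[OF assms(1)] assms(2) lower_nb_less[of T y x] by auto

lemma bounds:
  assumes "(x, y) \<in> T" "(y, z) \<in> T"
  obtains u v where "u \<le> x" "u \<le> y" "u \<le> z" "x \<le> v" "y \<le> v" "z \<le> v" "(u, y) \<in> T" "(y, v) \<in> T"
proof -
  have "\<forall>x y z. (x, y) \<in> T \<and> (y, z) \<in> T \<and> T \<noteq> UNIV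
        \<longrightarrow> (\<exists>u v. u \<le> x \<and> u \<le> y \<and> u \<le> z \<and> x \<le> v \<and> y \<le> v \<and> z \<le> v \<and>
                   (u, y) \<in> T \<and> (y, v) \<in> T)"
    using tol unfolding tolerance_def by (elim conjE)
  then show ?thesis using that proper assms by blast
qed

text \<open>A common upper bound \<open>v\<close> of \<open>x\<close> and \<open>z\<close> that is
  related to \<open>y\<close> covers \<open>y\<close>, so neither \<open>x\<close> nor
  \<open>z\<close> can lie strictly below \<open>v\<close>.\<close>

lemma upper_unique:
  assumes "lower_nb T y x" "lower_nb T y z"
  shows "x = z"
proof -
  obtain v where v: "x \<le> v" "z \<le> v" "(y, v) \<in> T"
    using bounds[of x y z] assms tolerance_sym[OF tol] lower_nb_rel by metis
  then have yv: "lower_nb T y v"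
    using related_lower_nb assms(1) lower_nb_less order.strict_trans2 by blast
  then show ?thesis
    using v assms lower_nb_between[OF yv] lower_nb_less by (metis order.not_eq_order_implies_strict)
qed

lemma lower_unique:
  assumes "lower_nb T x y" "lower_nb T z y"
  shows "x = z"
proof -
  obtain u where u: "u \<le> x" "u \<le> z" "(u, y) \<in> T"
    using bounds[of x y z] assms tolerance_sym[OF tol] lower_nb_rel by metis
  then have uy: "lower_nb T u y"
    using related_lower_nb assms(1) lower_nb_less order.strict_trans1 by blast
  then show ?thesis
    using u assms lower_nb_between[OF uy] lower_nb_less by (metis order.not_eq_order_implies_strict)
qed

lemma ex_neighbor: "(\<exists>y. lower_nb T x y) \<or> (\<exists>y. lower_nb T y x)"
proof -
  obtain y where "(x, y) \<in> T" "y \<noteq> x" by (rule ex_related_distinct[OF tol unif])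
  then show ?thesis using related_cases[of x y] by blast
qed

end

section \<open>Permuting tolerances are amicable\<close>

locale proper_two_uniform_pair = T: proper_two_uniform T + S: proper_two_uniform S
  for T S :: "('a::order \<times> 'a) set"
begin

text \<open>A \<open>d\<close> equal to \<open>a\<close> or \<open>b\<close>, or lying between them,
  would make \<open>a\<close> and \<open>b\<close> comparable; so it is above both or below
  both.\<close>

lemma permuting_square:
  assumes "T O S = S O T" "(a, c) \<in> T" "(c, b) \<in> S" "a \<noteq> b" "\<not> a < b" "\<not> b < a"
  obtains d where "lower_nb S a d" "lower_nb T b d" | d where "lower_nb S d a" "lower_nb T d b"
proof -
  obtain d where d: "(a, d) \<in> S" "(d, b) \<in> T" using assms(1-3) by blast
  have "lower_nb S a d \<and> lower_nb T b d \<or> lower_nb S d a \<and> lower_nb T d b"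
    using S.related_cases[OF d(1)] T.related_cases[OF d(2)] assms(4-6)
      order.strict_trans[OF lower_nb_less lower_nb_less, of S a d T b]
      order.strict_trans[OF lower_nb_less lower_nb_less, of T b d S a]
      lower_nb_less[of S a b] lower_nb_less[of S b a] lower_nb_less[of T a b] lower_nb_less[of T b a]
    by blast
  then show ?thesis using that by blast
qed

text \<open>A \<open>d\<close> below \<open>a\<close> would put \<open>a\<close> strictly inside the
  \<open>T\<close>-cover from \<open>d\<close> to \<open>b\<close>; a \<open>d\<close> above
  \<open>b\<close> would put \<open>b\<close> strictly inside the \<open>S\<close>-cover from
  \<open>a\<close> to \<open>d\<close>.\<close>

lemma permuting_path:
  assumes "T O S = S O T" "(a, c) \<in> T" "(c, b) \<in> S" "a < c" "c < b"
  obtains d where "lower_nb S a d" "lower_nb T d b"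
proof -
  obtain d where d: "(a, d) \<in> S" "(d, b) \<in> T" using assms(1-3) by blast
  \<comment> \<open>Excludes \<open>d = a\<close> and \<open>d = b\<close>, as \<open>c\<close> lies
    strictly between.\<close>
  have nb: "\<not> lower_nb T a b" "\<not> lower_nb S a b" using assms(4,5) lower_nb_between by blast+
  have ab: "a < b" using assms(4,5) by (rule order.strict_trans)
  have "\<not> lower_nb S d a"
  proof
    assume da: "lower_nb S d a"
    then have "d < b" using ab lower_nb_less order.strict_trans by blast
    then have "lower_nb T d b" using T.related_lower_nb d(2) by blast
    then show False using ab lower_nb_less[OF da] lower_nb_between by blast
  qed
  moreover have "\<not> lower_nb T b d"
  proof
    assume bd: "lower_nb T b d"
    then have "a < d" using ab lower_nb_less order.strict_trans by blast
    then have "lower_nb S a d" using S.related_lower_nb d(1) by blast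
    then show False using ab lower_nb_less[OF bd] lower_nb_between by blast
  qed
  ultimately have "lower_nb S a d \<and> lower_nb T d b"
    using S.related_cases[OF d(1)] T.related_cases[OF d(2)] nb ab by auto
  then show ?thesis using that by blast
qed

lemma permuting_upper_completion:
  assumes "T O S = S O T" "a \<noteq> b" "lower_nb T c a" "lower_nb S c b"
  shows "\<exists>d. lower_nb S a d \<and> lower_nb T b d"
proof -
  have inc: "\<not> a < b" "\<not> b < a" using assms(3,4) lower_nb_less lower_nb_between by blast+
  have "(a, c) \<in> T" "(c, b) \<in> S"
    using assms(3,4) lower_nb_rel tolerance_sym[OF T.tol] by blast+
  from assms(1) this assms(2) inc show ?thesis
  proof (rule permuting_square)
    fix d assume d: "lower_nb S d a" "lower_nb T d b"
    \<comment> \<open>Since \<open>c\<close> is below \<open>b\<close> and \<open>d\<close> is below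
      \<open>a\<close>, the joins are \<open>b\<close> and \<open>a\<close>: two incomparable
      elements would be related.\<close>
    have "(b, a) \<in> T"
    proof (rule tolerance_join[OF T.tol])
      show "(c, a) \<in> T" using assms(3) by (rule lower_nb_rel)
      show "(b, d) \<in> T" using d(2) lower_nb_rel tolerance_sym[OF T.tol] by blast
      show "isLub UNIV {c, b} b" using assms(4) lower_nb_less isLub_pair_le order.strict_implies_order by blast
      show "isLub UNIV {a, d} a"
        using d(1) lower_nb_less isLub_pair_le order.strict_implies_order insert_commute by metis
    qed
    then show ?thesis using T.related_cases[of b a] inc assms(2) lower_nb_less by blast
  qed blast
qed

lemma permuting_lower_completion:
  assumes "T O S = S O T" "a \<noteq> b" "lower_nb T a c" "lower_nb S b c"
  shows "\<exists>d. lower_nb S d a \<and> lower_nb T d b"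
proof -
  have inc: "\<not> a < b" "\<not> b < a" using assms(3,4) lower_nb_less lower_nb_between by blast+
  have "(a, c) \<in> T" "(c, b) \<in> S"
    using assms(3,4) lower_nb_rel tolerance_sym[OF S.tol] by blast+
  from assms(1) this assms(2) inc show ?thesis
  proof (rule permuting_square)
    fix d assume d: "lower_nb S a d" "lower_nb T b d"
    have "(b, a) \<in> T"
    proof (rule tolerance_meet[OF T.tol])
      show "(c, a) \<in> T" using assms(3) lower_nb_rel tolerance_sym[OF T.tol] by blast
      show "(b, d) \<in> T" using d(2) by (rule lower_nb_rel)
      show "isGlb UNIV {c, b} b"
        using assms(4) lower_nb_less isGlb_pair_le order.strict_implies_order insert_commute by metis
      show "isGlb UNIV {a, d} a"
        using d(1) lower_nb_less isGlb_pair_le order.strict_implies_order by blast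
    qed
    then show ?thesis using T.related_cases[of b a] inc assms(2) lower_nb_less by blast
  qed blast
qed

text \<open>Rerouting the ascending path from \<open>q\<close> through \<open>a\<close> to
  \<open>b\<close> gives \<open>b\<close> a lower \<open>S\<close>-neighbor.\<close>

lemma permuting_top_step:
  assumes "T O S = S O T" "is_top T S a" "lower_nb T a b"
  shows "is_top T S b"
proof -
  interpret sw: proper_two_uniform_pair S T by unfold_locales
  obtain q where "lower_nb S q a" using assms(2) by (auto simp: is_top_iff)
  then obtain d where "lower_nb T q d" "lower_nb S d b"
    using sw.permuting_path[OF assms(1)[symmetric], of q a b] assms(3) lower_nb_rel lower_nb_less
    by metis
  then show ?thesis using assms(3) by (auto simp: is_top_iff)
qed

lemma permuting_bottom_step:
  assumes "T O S = S O T" "is_bottom T S a" "lower_nb T b a"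
  shows "is_bottom T S b"
proof -
  obtain q where "lower_nb S a q" using assms(2) by (auto simp: is_bottom_iff)
  then obtain d where "lower_nb S b d" "lower_nb T d q"
    using permuting_path[OF assms(1), of b a q] assms(3) lower_nb_rel lower_nb_less by metis
  then show ?thesis using assms(3) by (auto simp: is_bottom_iff)
qed

lemma permuting_imp_amicable:
  assumes "T O S = S O T"
  shows "amicable T S"
proof -
  \<comment> \<open>The exchanged roles supply the top and bottom conditions for
    \<open>S\<close>-neighbors.\<close>
  interpret sw: proper_two_uniform_pair S T by unfold_locales
  show ?thesis
    unfolding amicable_iff
    using assms permuting_upper_completion permuting_lower_completion
      permuting_top_step permuting_bottom_step
      sw.permuting_top_step[OF assms[symmetric], unfolded is_top_iff]
      sw.permuting_bottom_step[OF assms[symmetric], unfolded is_bottom_iff]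
    unfolding is_top_iff is_bottom_iff by metis
qed

end

section \<open>Amicable tolerances permute\<close>

text \<open>A link of the never-ending chain: \<open>x\<close>, \<open>y\<close> are neither tops nor bottoms, and \<open>y\<close> must
  be left upwards by the other tolerance.\<close>

definition alternating_step :: "('a::order \<times> 'a) set \<Rightarrow> ('a \<times> 'a) set \<Rightarrow> 'a \<Rightarrow> 'a \<Rightarrow> bool"
  where "alternating_step T S x y \<longleftrightarrow>
    lower_nb T x y \<and> (\<nexists>z. lower_nb S x z) \<and> (\<nexists>z. lower_nb S z y) \<and> (\<nexists>z. lower_nb T y z)"

context proper_two_uniform_pair
begin

lemma alternating_step_extend:
  assumes am: "amicable T S" and step: "alternating_step T S x y"
  obtains z where "alternating_step S T y z"
proof -
  obtain z where z: "lower_nb S y z"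
    using S.ex_neighbor step unfolding alternating_step_def by blast
  have no_T: "\<not> lower_nb T h z" for h
  proof
    assume h: "lower_nb T h z"
    then have "h \<noteq> y" using step unfolding alternating_step_def by blast
    then obtain d where "lower_nb S d h" "lower_nb T d y"
      using am h z unfolding amicable_iff by blast
    \<comment> \<open>Uniqueness gives \<open>d = x\<close>, but \<open>x\<close> has no upper
      \<open>S\<close>-neighbor.\<close>
    then show False
      using T.lower_unique step unfolding alternating_step_def by metis
  qed
  have "\<not> lower_nb S z w" for w
  proof
    assume "lower_nb S z w"
    \<comment> \<open>With no lower \<open>T\<close>-neighbor, \<open>z\<close> must have an upper
      one.\<close>
    then have "is_bottom T S z"
      using T.ex_neighbor no_T by (auto simp: is_bottom_iff)
    then have "is_bottom T S y" using am z unfolding amicable_iff by blast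
    then show False using step by (auto simp: alternating_step_def is_bottom_iff)
  qed
  then have "alternating_step S T y z"
    using z no_T step unfolding alternating_step_def by blast
  then show ?thesis by (rule that)
qed

text \<open>The upper ends of links of both kinds would have a maximal element, yet every link
  extends strictly upwards.\<close>

lemma no_alternating_step:
  assumes am: "amicable T S" and wf: "wf {(y, x::'a). x < y}"
  shows "\<not> alternating_step T S x y"
proof
  interpret sw: proper_two_uniform_pair S T by unfold_locales
  assume "alternating_step T S x y"
  then have "y \<in> {y. \<exists>x. alternating_step T S x y \<or> alternating_step S T x y}" by blast
  with wf obtain m where m: "\<exists>x. alternating_step T S x m \<or> alternating_step S T x m"
    and max: "\<And>z. m < z \<Longrightarrow> \<nexists>x. alternating_step T S x z \<or> alternating_step S T x z"
    by (rule wfE_min) blast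
  then obtain z where "alternating_step T S m z \<or> alternating_step S T m z"
    using alternating_step_extend[OF am] sw.alternating_step_extend[OF amicable_sym[OF am]] by metis
  moreover from this have "m < z" by (auto simp: alternating_step_def lower_nb_less)
  ultimately show False using max by blast
qed

lemma amicable_path:
  assumes am: "amicable T S" and wf: "wf {(y, x::'a). x < y}"
    and ac: "lower_nb T a c" and cb: "lower_nb S c b"
  shows "\<exists>d. lower_nb S a d \<and> lower_nb T d b"
proof -
  have up: "\<exists>d. lower_nb S p d \<and> lower_nb T q d" if "p \<noteq> q" "lower_nb T r p" "lower_nb S r q" for p q r
    using am that unfolding amicable_iff by blast
  have down: "\<exists>d. lower_nb S d p \<and> lower_nb T d q" if "p \<noteq> q" "lower_nb T p r" "lower_nb S q r" for p q r
    using am that unfolding amicable_iff by blast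
  have top: "is_top T S q" if "is_top T S p" "lower_nb T p q \<or> lower_nb S p q" for p q
    using am that unfolding amicable_iff by blast
  have bottom: "is_bottom T S q" if "is_bottom T S p" "lower_nb T q p \<or> lower_nb S q p" for p q
    using am that unfolding amicable_iff by blast
  \<comment> \<open>\<open>up\<close> completes \<open>c\<close> and \<open>d\<close> to an element
    above both; uniqueness of upper \<open>S\<close>-neighbors makes it \<open>b\<close>.\<close>
  have via_a: ?thesis if "lower_nb S a d" "d \<noteq> c" for d
    using up[OF _ ac that(1)] that cb ac S.upper_unique by metis
  \<comment> \<open>\<open>down\<close> completes \<open>d\<close> and \<open>c\<close> to an
    element below both; uniqueness of lower \<open>T\<close>-neighbors makes it
    \<open>a\<close>.\<close>
  have via_b: ?thesis if "lower_nb T d b" "d \<noteq> c" for d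
    using down[OF _ that(1) cb] that ac T.lower_unique by metis
  consider (bot) "\<exists>e. lower_nb T c e" | (top) "\<exists>e. lower_nb S e c"
    | (neither) "\<nexists>e. lower_nb T c e" "\<nexists>e. lower_nb S e c" by blast
  then show ?thesis
  proof cases
    case bot
    then have "is_bottom T S c" using cb by (auto simp: is_bottom_iff)
    then have "is_bottom T S a" using bottom ac by blast
    then obtain d where d: "lower_nb S a d" by (auto simp: is_bottom_iff)
    show ?thesis
    proof (cases "d = c")
      case True
      then have "is_top T S c" using ac d by (auto simp: is_top_iff)
      then have "is_top T S b" using top cb by blast
      then obtain h where "lower_nb T h b" by (auto simp: is_top_iff)
      \<comment> \<open>If also \<open>h = c\<close>, then \<open>c\<close> itself is the required
        middle element.\<close>
      then show ?thesis using via_b d True by blast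
    qed (use via_a d in blast)
  next
    case top
    then have "is_top T S c" using ac by (auto simp: is_top_iff)
    then have "is_top T S b" using \<open>is_top T S c\<close> am cb unfolding amicable_iff by blast
    then obtain d where d: "lower_nb T d b" by (auto simp: is_top_iff)
    show ?thesis
    proof (cases "d = c")
      case True
      then have "is_bottom T S c" using cb d by (auto simp: is_bottom_iff)
      then have "is_bottom T S a" using bottom ac by blast
      then obtain h where "lower_nb S a h" by (auto simp: is_bottom_iff)
      then show ?thesis using via_a d True by blast
    qed (use via_b d in blast)
  next
    case neither
    \<comment> \<open>Otherwise \<open>a\<close> and \<open>c\<close> would form an alternating
      step.\<close>
    then have "\<exists>d. lower_nb S a d"
      using no_alternating_step[OF am wf, of a c] ac by (auto simp: alternating_step_def)
    then show ?thesis using via_a neither(2) by blast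
  qed
qed

lemma amicable_imp_subset:
  assumes am: "amicable T S" and wf: "wf {(y, x::'a). x < y}"
  shows "T O S \<subseteq> S O T"
proof clarify
  fix a c b assume ac: "(a, c) \<in> T" and cb: "(c, b) \<in> S"
  interpret sw: proper_two_uniform_pair S T by unfold_locales
  have *: "(a, b) \<in> S O T" if "(a, d) \<in> S" "(d, b) \<in> T" for d using that by blast
  note refls = tolerance_refl[OF T.tol] tolerance_refl[OF S.tol]
  note syms = tolerance_sym[OF T.tol] tolerance_sym[OF S.tol]
  show "(a, b) \<in> S O T"
  proof (cases "a = b \<or> a = c \<or> c = b")
    case True
    then show ?thesis using ac cb refls by blast
  next
    case False
    then consider "lower_nb T a c" "lower_nb S c b" | "lower_nb T a c" "lower_nb S b c"
      | "lower_nb T c a" "lower_nb S c b" | "lower_nb T c a" "lower_nb S b c"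
      using T.related_cases[OF ac] S.related_cases[OF cb] by blast
    then show ?thesis
    proof cases
      case 1
      then show ?thesis using amicable_path[OF am wf] lower_nb_rel * by metis
    next
      case 2
      then obtain d where "lower_nb S d a" "lower_nb T d b"
        using am False unfolding amicable_iff by metis
      then show ?thesis using lower_nb_rel syms * by metis
    next
      case 3
      then obtain d where "lower_nb S a d" "lower_nb T b d"
        using am False unfolding amicable_iff by metis
      then show ?thesis using lower_nb_rel syms * by metis
    next
      case 4
      \<comment> \<open>Read from \<open>b\<close> to \<open>a\<close>, the path ascends, first by
        \<open>S\<close> and then by \<open>T\<close>; hence the exchanged roles.\<close>
      then obtain d where "lower_nb T b d" "lower_nb S d a"
        using sw.amicable_path[OF amicable_sym[OF am] wf] by metis
      then show ?thesis using lower_nb_rel syms * by metis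
    qed
  qed
qed

lemma permuting_iff_amicable:
  assumes "wf {(y, x::'a). x < y}"
  shows "T O S = S O T \<longleftrightarrow> amicable T S"
proof
  interpret sw: proper_two_uniform_pair S T by unfold_locales
  assume "amicable T S"
  then show "T O S = S O T"
    using amicable_imp_subset sw.amicable_imp_subset amicable_sym assms by blast
qed (rule permuting_imp_amicable)

end

section \<open>The chain condition and the case of the full relation\<close>

lemma wf_greater_if_no_infinite_chain:
  assumes "\<not> (\<exists>C::'a::order set. Complete_Partial_Order.chain (\<le>) C \<and> infinite C)"
  shows "wf {(y, x::'a). x < y}"
proof (rule ccontr)
  assume "\<not> ?thesis"
  \<comment> \<open>Failure of well-foundedness yields a strictly increasing sequence, whose range
    is an infinite chain.\<close>
  then obtain f :: "nat \<Rightarrow> 'a" where "\<And>i. f i < f (Suc i)"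
    unfolding wf_iff_no_infinite_down_chain by blast
  then have f: "strict_mono f" by (simp add: strict_mono_Suc_iff)
  then have "infinite (range f)" by (simp add: finite_image_iff strict_mono_imp_inj_on)
  moreover have "Complete_Partial_Order.chain (\<le>) (range f)"
    unfolding Complete_Partial_Order.chain_def
    using strict_mono_less_eq[OF f] nat_le_linear by blast
  ultimately show False using assms by blast
qed

text \<open>The full relation has the whole poset as a block. This serves the case in which the last
  two tolerance axioms are void.\<close>

lemma two_uniform_UNIV:
  assumes "two_uniform (UNIV :: ('a \<times> 'a) set)"
  shows "card (UNIV :: 'a set) = 2"
  using assms unfolding two_uniform_def block_def by auto

text \<open>A block already has as many elements as the type, so it is everything.\<close>

lemma two_uniform_on_two_elements:
  assumes "card (UNIV :: 'a set) = 2" "two_uniform (S :: ('a \<times> 'a) set)"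
  shows "S = UNIV"
proof -
  obtain B where B: "block S B" by (rule ex_block_containing[of "{}" S]) auto
  have fin: "finite (UNIV :: 'a set)" using assms(1) card.infinite by fastforce
  have "card B = card (UNIV :: 'a set)" using assms B by (simp add: two_uniform_def)
  then have "B = UNIV" using card_subset_eq[OF fin subset_UNIV] by blast
  then show ?thesis using B unfolding block_def by auto
qed

text \<open>The premise of each condition needs three distinct elements, so all hold
  vacuously.\<close>

lemma amicable_on_two_elements:
  assumes "card (UNIV :: 'a::order set) = 2"
  shows "amicable T (S :: ('a \<times> 'a) set)"
proof -
  obtain p q :: 'a where pq: "UNIV = {p, q}" using assms by (auto simp: card_2_iff)
  have two: "x = y \<or> y = z \<or> x = z" for x y z :: 'a
    using UNIV_I[of x] UNIV_I[of y] UNIV_I[of z] unfolding pq by blast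
  have "\<not> (lower_nb U x y \<and> lower_nb V y z)" for x y z :: 'a and U V
    using two[of x y z] lower_nb_less[of U x y] lower_nb_less[of V y z] by auto
  moreover have "\<not> (lower_nb U c a \<and> lower_nb V c b \<and> a \<noteq> b)"
    "\<not> (lower_nb U a c \<and> lower_nb V b c \<and> a \<noteq> b)" for a b c :: 'a and U V
    using two[of a b c] lower_nb_less by blast+
  ultimately show ?thesis
    unfolding amicable_iff is_top_iff is_bottom_iff by metis
qed

theorem theorem3p3:
  fixes T S :: "('a::order \<times> 'a) set"
  assumes "tolerance T" and "two_uniform T"
    and "tolerance S" and "two_uniform S"
    and "\<not> (\<exists>C::'a set. Complete_Partial_Order.chain (\<le>) C \<and> infinite C)"
  shows "T O S = S O T \<longleftrightarrow> amicable T S"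
proof (cases "T = UNIV \<or> S = UNIV")
  case True
  \<comment> \<open>One full relation leaves only two elements, which makes the other full too; both
    sides of the equivalence then hold.\<close>
  then have two: "card (UNIV :: 'a set) = 2" using assms(2,4) two_uniform_UNIV by blast
  then have "T = UNIV" "S = UNIV" using assms(2,4) two_uniform_on_two_elements by blast+
  then show ?thesis using amicable_on_two_elements[OF two] by blast
next
  case False
  then interpret proper_two_uniform_pair T S
    using assms(1-4) by unfold_locales auto
  show ?thesis using wf_greater_if_no_infinite_chain[OF assms(5)] by (rule permuting_iff_amicable)
qed

end
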